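(* There is a function $\varepsilon(n)$ with $\varepsilon(n)\to 0$ as $n\to\infty$ such that the following holds: if an $n$-vertex graph $G$ is an $(n/4,t)$-Ruzsa–Szemerédi graph, then $t \le (6+\varepsilon(n))\log_2 n$.
   Context: All graphs are finite and simple. A matching $M$ in a graph $G$ is an induced matching if the subgraph of $G$ induced on the set of vertices covered by $M$ has edge set exactly $M$. A graph $G$ is an $(r,t)$-Ruzsa–Szemerédi graph if its edge set can be partitioned into $t$ pairwise edge-disjoint induced matchings, each consisting of exactly $r$ edges. *)

theory Defs
  imports Complex_Main "HOL-Library.Disjoint_Sets"
begin

text \<open>A graph is a vertex set together with a set of two-element subsets of it.\<close>

definition finite_simple_graph :: "'a set \<Rightarrow> 'a set set \<Rightarrow> bool" where
  "finite_simple_graph V E \<longleftrightarrow> finite V \<and> (\<forall>e\<in>E. e \<subseteq> V \<and> card e = 2)"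

definition matching :: "'a set set \<Rightarrow> 'a set set \<Rightarrow> bool" where
  "matching E M \<longleftrightarrow> M \<subseteq> E \<and> disjoint M"

definition induced_edges :: "'a set set \<Rightarrow> 'a set \<Rightarrow> 'a set set" where
  "induced_edges E W = {e \<in> E. e \<subseteq> W}"

definition induced_matching :: "'a set set \<Rightarrow> 'a set set \<Rightarrow> bool" where
  "induced_matching E M \<longleftrightarrow> matching E M \<and> induced_edges E (\<Union>M) = M"

text \<open>
  The blocks of \<^const>\<open>partition_on\<close> are nonempty, so \<open>r = 0\<close> forces \<open>t = 0\<close>.
\<close>

definition ruzsa_szemeredi_graph ::
    "'a set \<Rightarrow> 'a set set \<Rightarrow> nat \<Rightarrow> nat \<Rightarrow> bool" where
  "ruzsa_szemeredi_graph V E r t \<longleftrightarrow>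
     finite_simple_graph V E \<and>
     (\<exists>P. partition_on E P \<and> card P = t \<and>
          (\<forall>M\<in>P. induced_matching E M \<and> card M = r))"

end

theory Submission
  imports Defs "HOL-Analysis.Convex"
begin

text \<open>
  Let \<open>S u\<close> be the set of matchings covering \<open>u\<close>. If \<open>uv\<close> belongs to the matching \<open>M\<close>, then
  \<open>S u\<close> and \<open>S v\<close> meet only in \<open>M\<close>, and as every matching covers half of the vertices, convexity shows
  that on average at most one matching avoids both \<open>u\<close> and \<open>v\<close>. Hence \<open>S u\<close> is nearly
  the complement of \<open>S v\<close>, and the bipartite double cover of the graph nearly maps to a
  hypercube. List the matchings in some order, and call \<open>uv\<close> resolved if \<open>M\<close> is listed before all
  matchings that avoid \<open>u\<close> and \<open>v\<close>. At least half of the edges are resolved, on average over the order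
  and its reverse. Splitting the double cover one coordinate at a time, as in the
  proof of the edge-isoperimetric inequality of the hypercube, bounds the number of
  resolved edges by \<open>N log\<^sub>2 N / 2\<close> with \<open>N = 2n\<close>. This gives \<open>t \<le> 4 log\<^sub>2 (2n)\<close>.
\<close>

section \<open>Superadditivity of \<open>x * log 2 x\<close>\<close>

lemma le_log2_add_one:
  fixes u :: real
  assumes "0 \<le> u" "u \<le> 1"
  shows "u \<le> log 2 (1 + u)"
proof -
  \<comment> \<open>On the interval from 0 to \<open>ln 2\<close>, \<open>exp\<close> lies below its
    chord.\<close>
  have "exp ((1 - u) *\<^sub>R 0 + u *\<^sub>R ln 2) \<le> (1 - u) * exp 0 + u * exp (ln 2)"
    using assms by (intro convex_onD[OF exp_convex]) auto
  then have "2 powr u \<le> 1 + u"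
    by (simp add: powr_def)
  then show ?thesis
    using assms by (simp add: le_log_iff)
qed

text \<open>Each summand grows by at least \<open>x\<close>: the factor \<open>(x + y) / x\<close>
  is at least 2, and \<open>log 2 (1 + x / y)\<close> is at least \<open>x / y\<close>.\<close>

lemma xlog_superadditive_aux:
  fixes x y :: real
  assumes "0 < x" "x \<le> y"
  shows "x * log 2 x + y * log 2 y + 2 * x \<le> (x + y) * log 2 (x + y)"
proof -
  have "1 \<le> log 2 ((x + y) / x)"
    using assms by (simp add: le_log_iff field_simps)
  then have 1: "x \<le> x * (log 2 (x + y) - log 2 x)"
    using assms by (simp add: log_divide)
  have "x / y \<le> log 2 (1 + x / y)"
    using assms by (intro le_log2_add_one) auto
  also have "1 + x / y = (x + y) / y"
    using assms by (simp add: field_simps)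
  finally have "x \<le> y * (log 2 (x + y) - log 2 y)"
    using assms by (simp add: log_divide field_simps)
  with 1 show ?thesis
    by (simp add: algebra_simps)
qed

text \<open>The surplus \<open>2 * min x y\<close> pays for the edges that run between the two
  halves in each splitting step below.\<close>

lemma xlog_superadditive:
  fixes x y :: real
  assumes "0 \<le> x" "0 \<le> y"
  shows "x * log 2 x + y * log 2 y + 2 * min x y \<le> (x + y) * log 2 (x + y)"
  using assms xlog_superadditive_aux[of x y] xlog_superadditive_aux[of y x]
  by (cases "x = 0 \<or> y = 0") (auto simp: min_def add.commute)

section \<open>Counting resolved pairs by successive splitting\<close>

fun resolved :: "'a set set list \<Rightarrow> 'a \<Rightarrow> 'a \<Rightarrow> bool" where
  "resolved [] u v \<longleftrightarrow> False"
| "resolved (M # Ms) u v \<longleftrightarrow>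
     {u, v} \<in> M \<or> (u \<in> \<Union>M \<longleftrightarrow> v \<notin> \<Union>M) \<and> resolved Ms u v"

lemma resolved_append:
  assumes "{u, v} \<in> M" "\<And>N. N \<in> set Ms \<Longrightarrow> u \<in> \<Union>N \<longleftrightarrow> v \<notin> \<Union>N"
  shows "resolved (Ms @ M # Ns) u v"
  using assms by (induction Ms) auto

definition resolved_pairs :: "'a set set list \<Rightarrow> 'a set \<Rightarrow> 'a set \<Rightarrow> ('a \<times> 'a) set" where
  "resolved_pairs Ms A B = {(u, v) \<in> A \<times> B. resolved Ms u v}"

lemma finite_resolved_pairs:
  "finite A \<Longrightarrow> finite B \<Longrightarrow> finite (resolved_pairs Ms A B)"
  by (rule finite_subset[of _ "A \<times> B"]) (auto simp: resolved_pairs_def)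

lemma disjoint_pair_unique:
  assumes "disjoint M" "{u, v} \<in> M" "{u, w} \<in> M"
  shows "v = w"
proof -
  have "{u, v} = {u, w}"
    using assms by (meson disjointD disjoint_iff insertI1)
  then show ?thesis
    by (auto simp: doubleton_eq_iff)
qed

text \<open>Here \<open>A\<close> and \<open>B\<close> are the two sides of a double cover, so they
  may overlap. Pairs that survive the first matching join \<open>?A1\<close> to \<open>?B0\<close>
  or \<open>?A0\<close> to \<open>?B1\<close>, hence the generality in \<open>A\<close> and
  \<open>B\<close> for the induction. Pairs settled at once are counted by \<open>F\<close> and
  absorbed by the surplus in superadditivity.\<close>

lemma card_resolved_pairs:
  assumes "\<And>M. M \<in> set Ms \<Longrightarrow> disjoint M" "finite A" "finite B"
  shows "2 * real (card (resolved_pairs Ms A B)) \<le>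
    real (card A + card B) * log 2 (real (card A + card B))"
  using assms
proof (induction Ms arbitrary: A B)
  case Nil
  then show ?case
    by (cases "card A + card B") (auto simp: resolved_pairs_def)
next
  case (Cons M Ms)
  define X where "X = \<Union>M"
  let ?A1 = "A \<inter> X" and ?A0 = "A - X" and ?B1 = "B \<inter> X" and ?B0 = "B - X"
  define F where "F = {(u, v) \<in> ?A1 \<times> ?B1. {u, v} \<in> M}"
  have "disjoint M"
    using Cons.prems by simp
  note uniq = disjoint_pair_unique[OF this]
  have "card F \<le> card ?A1"
    using Cons.prems uniq
    by (intro card_inj_on_le[of fst]) (auto simp: F_def inj_on_def)
  moreover have "card F \<le> card ?B1"
    using Cons.prems uniq
    by (intro card_inj_on_le[of snd]) (auto simp: F_def inj_on_def insert_commute)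
  \<comment> \<open>\<open>F\<close> injects into \<open>?A1\<close> and into \<open>?B1\<close>,
    which belong to different halves of the split.\<close>
  ultimately have F: "card F \<le> min (card ?A1 + card ?B0) (card ?A0 + card ?B1)"
    by simp
  have "finite F"
    using Cons.prems by (intro finite_subset[of F "A \<times> B"]) (auto simp: F_def)
  have "resolved_pairs (M # Ms) A B \<subseteq>
      F \<union> (resolved_pairs Ms ?A1 ?B0 \<union> resolved_pairs Ms ?A0 ?B1)"
    by (auto simp: resolved_pairs_def F_def X_def)
  then have "card (resolved_pairs (M # Ms) A B) \<le>
      card (F \<union> (resolved_pairs Ms ?A1 ?B0 \<union> resolved_pairs Ms ?A0 ?B1))"
    using Cons.prems \<open>finite F\<close> by (intro card_mono) (auto simp: finite_resolved_pairs)
  also have "\<dots> \<le> card F + (card (resolved_pairs Ms ?A1 ?B0) + card (resolved_pairs Ms ?A0 ?B1))"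
    by (meson card_Un_le add_left_mono order_trans)
  finally have "2 * real (card (resolved_pairs (M # Ms) A B)) \<le>
      2 * min (real (card ?A1 + card ?B0)) (real (card ?A0 + card ?B1))
      + (2 * real (card (resolved_pairs Ms ?A1 ?B0)) + 2 * real (card (resolved_pairs Ms ?A0 ?B1)))"
    using F by (auto simp: min_def split: if_splits)
  also have "\<dots> \<le> 2 * min (real (card ?A1 + card ?B0)) (real (card ?A0 + card ?B1))
      + (real (card ?A1 + card ?B0) * log 2 (real (card ?A1 + card ?B0))
       + real (card ?A0 + card ?B1) * log 2 (real (card ?A0 + card ?B1)))"
    using Cons.prems by (intro add_left_mono add_mono Cons.IH) auto
  also have "\<dots> \<le> (real (card ?A1 + card ?B0) + real (card ?A0 + card ?B1)) *
      log 2 (real (card ?A1 + card ?B0) + real (card ?A0 + card ?B1))"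
    using xlog_superadditive[of "real (card ?A1 + card ?B0)" "real (card ?A0 + card ?B1)"]
    by simp
  also have "real (card ?A1 + card ?B0) + real (card ?A0 + card ?B1) = real (card A + card B)"
    using card_Int_Diff[of A X] card_Int_Diff[of B X] Cons.prems by simp
  finally show ?case .
qed

section \<open>Structure of a partition into induced matchings\<close>

locale induced_matching_partition =
  fixes V :: "'a set" and E :: "'a set set" and P :: "'a set set set"
  assumes graph: "finite_simple_graph V E"
    and partition: "partition_on E P"
    and induced: "\<And>M. M \<in> P \<Longrightarrow> induced_matching E M"
begin

definition cover :: "'a \<Rightarrow> 'a set set set" where
  "cover u = {M \<in> P. u \<in> \<Union>M}"

lemma finite_V: "finite V"
  and edge_subset: "e \<in> E \<Longrightarrow> e \<subseteq> V"
  and card_edge: "e \<in> E \<Longrightarrow> card e = 2"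
  using graph by (auto simp: finite_simple_graph_def)

lemma finite_E: "finite E"
  using finite_V edge_subset by (intro finite_subset[of E "Pow V"]) auto

lemma finite_P: "finite P"
  using finite_E partition by (rule finite_elements)

lemma matching_subset: "M \<in> P \<Longrightarrow> M \<subseteq> E"
  and disjoint_matching: "M \<in> P \<Longrightarrow> disjoint M"
  using induced by (auto simp: induced_matching_def matching_def)

lemma Union_matching_subset: "M \<in> P \<Longrightarrow> \<Union>M \<subseteq> V"
  using matching_subset edge_subset by blast

lemma E_eq_Union: "E = \<Union>P"
  using partition by (simp add: partition_on_def)

lemma matching_unique:
  "\<lbrakk>M \<in> P; N \<in> P; e \<in> M; e \<in> N\<rbrakk> \<Longrightarrow> M = N"
  using partition by (meson partition_onD2 disjointD disjoint_iff)

text \<open>Inducedness enters here: a matching covering both ends of an edge must contain that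
  edge, and only one matching does.\<close>

lemma cover_Int:
  assumes "M \<in> P" "{u, v} \<in> M"
  shows "cover u \<inter> cover v = {M}"
proof
  show "{M} \<subseteq> cover u \<inter> cover v"
    using assms by (auto simp: cover_def)
  show "cover u \<inter> cover v \<subseteq> {M}"
  proof
    fix N
    assume N: "N \<in> cover u \<inter> cover v"
    then have "N \<in> P" "{u, v} \<subseteq> \<Union>N"
      by (auto simp: cover_def)
    moreover have "{u, v} \<in> E"
      using assms matching_subset by blast
    ultimately have "{u, v} \<in> N"
      using induced[of N] unfolding induced_matching_def induced_edges_def by blast
    then show "N \<in> {M}"
      using matching_unique assms \<open>N \<in> P\<close> by blast
  qed
qed

text \<open>The left side is 2 minus the number of matchings avoiding both ends. With none, both
  orders resolve the pair; a single one comes after \<open>M\<close> in one of the two orders; with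
  more, the left side is at most 0.\<close>

lemma resolved_either_direction:
  assumes Ms: "set Ms = P" "distinct Ms" and uv: "{u, v} \<in> E"
  shows "1 - int (card P) + int (card (cover u)) + int (card (cover v))
    \<le> of_bool (resolved Ms u v) + of_bool (resolved (rev Ms) u v)"
proof -
  obtain M where M: "M \<in> P" "{u, v} \<in> M"
    using uv E_eq_Union by auto
  define D where "D = P - (cover u \<union> cover v)"
  have cover_P: "cover u \<union> cover v \<subseteq> P"
    by (auto simp: cover_def)
  then have fin: "finite (cover u)" "finite (cover v)" "finite D"
    using finite_P by (auto simp: D_def dest: finite_subset)
  have "card (cover u) + card (cover v) = card (cover u \<union> cover v) + 1"
    using card_Un_Int[OF fin(1,2)] cover_Int[OF M] by simp
  moreover have "card P = card D + card (cover u \<union> cover v)"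
    unfolding D_def using card_Int_Diff[OF finite_P, of "cover u \<union> cover v"] Int_absorb1[OF cover_P]
    by simp
  ultimately have lhs: "1 - int (card P) + int (card (cover u)) + int (card (cover v))
      = 2 - int (card D)"
    by simp
  obtain ys zs where split: "Ms = ys @ M # zs"
    using M Ms by (metis split_list)
  \<comment> \<open>Outside \<open>D\<close> at least one end is covered; other than at
    \<open>M\<close>, never both.\<close>
  have flip: "u \<in> \<Union>N \<longleftrightarrow> v \<notin> \<Union>N" if "N \<in> P" "N \<notin> D" "N \<noteq> M" for N
    using that cover_Int[OF M] unfolding D_def cover_def by blast
  have fwd: "resolved Ms u v" if "set ys \<inter> D = {}"
    unfolding split using M(2)
  proof (rule resolved_append)
    fix N assume "N \<in> set ys"
    with that Ms split show "u \<in> \<Union>N \<longleftrightarrow> v \<notin> \<Union>N"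
      by (intro flip) auto
  qed
  have "resolved (rev zs @ M # rev ys) u v" if "set zs \<inter> D = {}"
    using M(2)
  proof (rule resolved_append)
    fix N assume "N \<in> set (rev zs)"
    with that Ms split show "u \<in> \<Union>N \<longleftrightarrow> v \<notin> \<Union>N"
      by (intro flip) auto
  qed
  then have bwd: "resolved (rev Ms) u v" if "set zs \<inter> D = {}"
    using that split by simp
  consider "card D = 0" | "card D = 1" | "card D \<ge> 2"
    by linarith
  then show ?thesis
  proof cases
    case 1
    then have "D = {}"
      using fin by simp
    then show ?thesis
      using fwd bwd lhs by simp
  next
    case 2
    then obtain N where "D = {N}"
      by (auto simp: card_1_singleton_iff)
    then have "set ys \<inter> D = {} \<or> set zs \<inter> D = {}"
      using Ms split by auto
    then show ?thesis
      using fwd bwd lhs \<open>card D = 1\<close> by auto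
  next
    case 3
    then show ?thesis
      using lhs by simp
  qed
qed

section \<open>Degrees and incidences\<close>

lemma card_partners:
  assumes "M \<in> P"
  shows "card {v. {u, v} \<in> M} = of_bool (M \<in> cover u)"
proof (cases "u \<in> \<Union>M")
  case True
  then obtain e where e: "e \<in> M" "u \<in> e"
    by blast
  then obtain v where "e = {u, v}"
    using assms matching_subset card_edge[of e] by (auto simp: card_2_iff)
  then have "{v. {u, v} \<in> M} = {v}"
    using e disjoint_pair_unique[OF disjoint_matching[OF assms]] by blast
  then show ?thesis
    using True assms by (simp add: cover_def)
next
  case False
  then have "{v. {u, v} \<in> M} = {}"
    by auto
  with False show ?thesis
    by (simp add: cover_def)
qed

text \<open>Each matching covering \<open>u\<close> contributes one neighbour, and distinct
  matchings contribute distinct ones.\<close>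

lemma card_neighbours: "card {v. {u, v} \<in> E} = card (cover u)"
proof -
  have "{v. {u, v} \<in> E} = (\<Union>M\<in>P. {v. {u, v} \<in> M})"
    using E_eq_Union by auto
  also have "card \<dots> = (\<Sum>M\<in>P. card {v. {u, v} \<in> M})"
  proof (rule card_UN_disjoint[OF finite_P])
    show "\<forall>M\<in>P. finite {v. {u, v} \<in> M}"
    proof
      fix M assume "M \<in> P"
      then have "{v. {u, v} \<in> M} \<subseteq> V"
        using Union_matching_subset by blast
      then show "finite {v. {u, v} \<in> M}"
        using finite_V finite_subset by blast
    qed
    show "\<forall>M\<in>P. \<forall>N\<in>P. M \<noteq> N \<longrightarrow> {v. {u, v} \<in> M} \<inter> {v. {u, v} \<in> N} = {}"
      using matching_unique by blast
  qed
  also have "\<dots> = (\<Sum>M\<in>P. of_bool (M \<in> cover u))"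
    by (intro sum.cong refl card_partners)
  also have "\<dots> = card (cover u)"
    using finite_P by (simp add: cover_def Int_def)
  finally show ?thesis .
qed

lemma sum_cover:
  assumes "\<And>M. M \<in> P \<Longrightarrow> card M = r"
  shows "(\<Sum>u\<in>V. card (cover u)) = 2 * r * card P"
proof -
  have "(\<Sum>u\<in>V. card (cover u)) = (\<Sum>M\<in>P. card {u \<in> V. u \<in> \<Union>M})"
    unfolding cover_def using finite_V finite_P
    by (intro sum_multicount_gen) auto
  also have "\<dots> = (\<Sum>M\<in>P. 2 * r)"
  proof (rule sum.cong)
    fix M assume M: "M \<in> P"
    have "{u \<in> V. u \<in> \<Union>M} = \<Union>M"
      using Union_matching_subset[OF M] by blast
    also have "card \<dots> = sum card M"
    proof (rule card_Union_disjoint)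
      show "pairwise disjnt M"
        using disjoint_matching[OF M] by (auto simp: disjoint_def pairwise_def disjnt_def)
      show "finite e" if "e \<in> M" for e
        using that matching_subset[OF M] edge_subset finite_V by (meson finite_subset subsetD)
    qed
    also have "\<dots> = (\<Sum>e\<in>M. 2)"
      using matching_subset[OF M] card_edge by (intro sum.cong) auto
    also have "\<dots> = 2 * r"
      using assms[OF M] by simp
    finally show "card {u \<in> V. u \<in> \<Union>M} = 2 * r" .
  qed simp
  finally show ?thesis
    by simp
qed

section \<open>Averaging over oriented edges\<close>

lemma card_partition_le:
  assumes r: "\<And>M. M \<in> P \<Longrightarrow> card M = r" "card V = 4 * r" "r > 0"
  shows "real (card P) \<le> 4 * log 2 (2 * real (card V))"
proof -
  define n t where "n = card V" and "t = card P"
  define d where "d u = card (cover u)" for u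
  obtain Ms where Ms: "set Ms = P" "distinct Ms"
    using finite_distinct_list[OF finite_P] by blast
  \<comment> \<open>Every edge appears in both orientations, as in the double cover.\<close>
  define A where "A = (SIGMA u:V. {v. {u, v} \<in> E})"
  have nb: "{v. {u, v} \<in> E} \<subseteq> V" for u
    using edge_subset by blast
  then have fin_nb: "finite {v. {u, v} \<in> E}" for u
    using finite_V finite_subset by blast
  have A: "A = {(u, v). {u, v} \<in> E}" "A \<subseteq> V \<times> V"
    using edge_subset by (auto simp: A_def)
  then have fin_A: "finite A"
    using finite_V finite_subset by blast
  have sum_d: "(\<Sum>u\<in>V. real (d u)) = real n * real t / 2"
    using arg_cong[OF sum_cover[of r], of real] r by (simp add: d_def n_def t_def)
  have sum_fst: "(\<Sum>(u, v)\<in>A. f u) = (\<Sum>u\<in>V. real (d u) * f u)" for f :: "'a \<Rightarrow> real"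
    unfolding A_def using finite_V fin_nb
    by (simp add: sum.Sigma[symmetric] card_neighbours d_def)
  have sum_snd: "(\<Sum>(u, v)\<in>A. f v) = (\<Sum>(u, v)\<in>A. f u)" for f :: "'a \<Rightarrow> real"
    by (rule sum.reindex_bij_witness[of _ prod.swap prod.swap]) (auto simp: A insert_commute)
  have card_A: "real (card A) = real n * real t / 2"
    using sum_fst[of "\<lambda>_. 1"] sum_d by simp
  \<comment> \<open>The mean of \<open>d\<close> is \<open>t / 2\<close>, as each matching covers
    half of \<open>V\<close>; nonnegative variance bounds the sum of squares.\<close>
  have "0 \<le> (\<Sum>u\<in>V. (real (d u) - real t / 2)\<^sup>2)"
    by (intro sum_nonneg) auto
  also have "\<dots> = (\<Sum>u\<in>V. real (d u) * real (d u)) - real t * (\<Sum>u\<in>V. real (d u))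
      + real n * (real t)\<^sup>2 / 4"
    by (simp add: power2_eq_square algebra_simps sum.distrib sum_subtractf sum_distrib_left n_def)
  finally have sq: "real n * (real t)\<^sup>2 / 4 \<le> (\<Sum>u\<in>V. real (d u) * real (d u))"
    unfolding sum_d by (simp add: power2_eq_square)
  \<comment> \<open>The right side is the value for constant degree \<open>t / 2\<close>; its terms
    quadratic in \<open>t\<close> cancel.\<close>
  have "real n * real t / 2 = real n * real t / 2 * (1 - real t) + 2 * (real n * (real t)\<^sup>2 / 4)"
    by (simp add: power2_eq_square field_simps)
  also have "\<dots> \<le> real (card A) * (1 - real t) + 2 * (\<Sum>u\<in>V. real (d u) * real (d u))"
    using sq unfolding card_A by (intro add_mono mult_left_mono) auto
  also have "\<dots> = (\<Sum>(u, v)\<in>A. 1 - real t + real (d u) + real (d v))"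
    using sum_fst[of "\<lambda>u. real (d u)"] sum_snd[of "\<lambda>u. real (d u)"]
    by (simp add: sum.distrib case_prod_unfold)
  also have "\<dots> \<le> (\<Sum>(u, v)\<in>A. of_bool (resolved Ms u v) + of_bool (resolved (rev Ms) u v))"
  proof (rule sum_mono, clarify)
    fix u v assume "(u, v) \<in> A"
    then have "real_of_int (1 - int t + int (d u) + int (d v)) \<le>
        real_of_int (of_bool (resolved Ms u v) + of_bool (resolved (rev Ms) u v))"
      unfolding d_def t_def
      by (intro of_int_le_iff[THEN iffD2] resolved_either_direction Ms) (simp add: A)
    then show "1 - real t + real (d u) + real (d v) \<le>
        of_bool (resolved Ms u v) + of_bool (resolved (rev Ms) u v)"
      by simp
  qed
  also have "\<dots> = real (card {(u, v) \<in> A. resolved Ms u v})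
      + real (card {(u, v) \<in> A. resolved (rev Ms) u v})"
    using fin_A by (simp add: sum.distrib case_prod_unfold Int_def)
  also have "\<dots> \<le> real (card (resolved_pairs Ms V V)) + real (card (resolved_pairs (rev Ms) V V))"
    using A finite_V
    by (intro add_mono of_nat_mono card_mono finite_resolved_pairs) (auto simp: resolved_pairs_def)
  \<comment> \<open>Each of the two orders accounts for at most half of this bound.\<close>
  also have "\<dots> \<le> real (n + n) * log 2 (real (n + n))"
    using card_resolved_pairs[of Ms V V] card_resolved_pairs[of "rev Ms" V V]
      Ms disjoint_matching finite_V by (simp add: n_def)
  finally have "real n * real t \<le> real n * (4 * log 2 (2 * real n))"
    by simp
  moreover have "n > 0"
    using r by (simp add: n_def)
  ultimately show ?thesis
    by (simp add: n_def t_def)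
qed

end

theorem theorem1p2:
  "\<exists>\<epsilon> :: nat \<Rightarrow> real. \<epsilon> \<longlonglongrightarrow> 0 \<and>
     (\<forall>(V :: 'a set) E n r t.
        card V = n \<longrightarrow> real r = real n / 4 \<longrightarrow> ruzsa_szemeredi_graph V E r t \<longrightarrow>
        real t \<le> (6 + \<epsilon> n) * log 2 (real n))"
proof (intro exI conjI allI impI)
  \<comment> \<open>The zero function suffices: \<open>4 * (1 + log 2 n)\<close> is at most
    \<open>6 * log 2 n\<close> once \<open>n\<close> is at least 4.\<close>
  show "(\<lambda>_. 0 :: real) \<longlonglongrightarrow> 0"
    by simp
next
  fix V :: "'a set" and E n r t
  assume n: "card V = n" "real r = real n / 4" and "ruzsa_szemeredi_graph V E r t"
  then obtain P where graph: "finite_simple_graph V E" and P: "partition_on E P" "card P = t"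
    and M: "\<And>M. M \<in> P \<Longrightarrow> induced_matching E M \<and> card M = r"
    unfolding ruzsa_szemeredi_graph_def by blast
  interpret induced_matching_partition V E P
    using graph P M by unfold_locales auto
  show "real t \<le> (6 + 0) * log 2 (real n)"
  proof (cases "r = 0")
    case True
    \<comment> \<open>A block of size 0 would be empty, which \<open>partition_on\<close>
      excludes.\<close>
    have "N \<notin> P" for N
      using M[of N] True matching_subset[of N] finite_E partition_onD3[OF P(1)]
      by (metis card_0_eq finite_subset)
    then have "t = 0"
      using P by (metis card.empty equals0I)
    \<comment> \<open>Now \<open>n = 0\<close>, and \<open>log 2 0\<close> takes the default value
      0.\<close>
    with True n show ?thesis
      by (simp add: log_def)
  next
    case False
    then have n4: "n = 4 * r" "n \<ge> 4"
      using n by linarith+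
    then have "2 \<le> log 2 (real n)"
      by (simp add: le_log_iff)
    moreover have "log 2 (2 * real n) = 1 + log 2 (real n)"
      using n4 by (subst log_mult_pos) auto
    moreover have "real t \<le> 4 * log 2 (2 * real n)"
      using card_partition_le[of r] M n(1) n4(1) P(2) False by blast
    ultimately show ?thesis
      by simp
  qed
qed

end
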